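(* Let $V_1,\ldots,V_k$ be archimedean subsemimodules of $\mathbf{R}_{\max,\mathrm{m}}^n$ that are closed in the Euclidean topology, and write $P_i=P_{V_i}$ for the projector onto $V_i$. The following are equivalent: 1. there exist a positive vector $x$ (all entries positive) and a number $\lambda<1$ such that $P_k\cdots P_1x\le\lambda x$; 2. there exist archimedean halfspaces $H_i$, $i=1,\ldots,k$, such that $V_i\subseteq H_i$ and $H_1\cap\cdots\cap H_k=\{0\}$; 3. $V_1\cap\cdots\cap V_k=\{0\}$; 4. $\rho(P_k\cdots P_1)<1$.
   Context: $\mathbf{R}_{\max,\mathrm{m}}$ is the max-times semiring: the set $\mathbf{R}_+$ of nonnegative reals with addition $a\oplus b=\max(a,b)$ and the usual multiplication. $\mathbf{R}_{\max,\mathrm{m}}^n$ is $\mathbf{R}_+^n$ with entrywise $\oplus$ and scalar multiplication, ordered entrywise; scalars are elements of $\mathbf{R}_+$. A subsemimodule is a subset containing $0$ and closed under $\oplus$ and under multiplication by scalars from $\mathbf{R}_+$; it is archimedean if it contains a vector with all entries positive. For a closed subsemimodule $V$, the projector onto $V$ is $P_V(x)=\max\{u\in V\mid u\le x\}$, $x\in\mathbf{R}_+^n$ (the maximum exists). An archimedean halfspace is a set of the form $H=\{x\in\mathbf{R}_+^n \mid \max_{1\le i\le n} x_iu_i^{-1}\le \max_{1\le i\le n} x_iv_i^{-1}\}$, where $u,v$ have all entries positive and $u\le v$. For a continuous homogeneous isotone map $F:\mathbf{R}_+^n\to\mathbf{R}_+^n$ (projectors onto closed subsemimodules, and their compositions,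 are such maps), the spectral radius is $\rho(F)=\max\{\lambda\in\mathbf{R}_+\mid\exists x\in\mathbf{R}_+^n\setminus\{0\},\ Fx=\lambda x\}$. *)

theory Defs
  imports "HOL-Analysis.Analysis"
begin

text \<open>
  The order on \<^typ>\<open>real ^ 'n\<close> is the entrywise one, so \<^const>\<open>sup\<close> is the entrywise maximum,
  i.e. the max-times addition. Strict positivity needs a separate predicate, because
  \<open>0 < x\<close> on vectors only means \<open>0 \<le> x \<and> x \<noteq> 0\<close>.
\<close>

definition nonneg_orthant :: "(real ^ 'n::finite) set" where
  "nonneg_orthant = {x. 0 \<le> x}"

definition positive_vec :: "real ^ 'n::finite \<Rightarrow> bool" where
  "positive_vec x \<longleftrightarrow> (\<forall>i. 0 < x $ i)"

definition subsemimodule :: "(real ^ 'n::finite) set \<Rightarrow> bool" where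
  "subsemimodule V \<longleftrightarrow>
     V \<subseteq> nonneg_orthant \<and> 0 \<in> V \<and>
     (\<forall>x\<in>V. \<forall>y\<in>V. sup x y \<in> V) \<and>
     (\<forall>a\<ge>0. \<forall>x\<in>V. a *\<^sub>R x \<in> V)"

definition archimedean_subsemimodule :: "(real ^ 'n::finite) set \<Rightarrow> bool" where
  "archimedean_subsemimodule V \<longleftrightarrow> subsemimodule V \<and> (\<exists>x\<in>V. positive_vec x)"

text \<open>Only meaningful on the nonnegative orthant and for closed subsemimodules.\<close>

definition projector :: "(real ^ 'n::finite) set \<Rightarrow> real ^ 'n \<Rightarrow> real ^ 'n" where
  "projector V x = (GREATEST u. u \<in> V \<and> u \<le> x)"

text \<open>The projector onto \<open>V 1\<close> acts first.\<close>

primrec cyclic_projector :: "(nat \<Rightarrow> (real ^ 'n::finite) set) \<Rightarrow> nat \<Rightarrow> real ^ 'n \<Rightarrow> real ^ 'n" where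
  "cyclic_projector V 0 = id"
| "cyclic_projector V (Suc k) = projector (V (Suc k)) \<circ> cyclic_projector V k"

definition archimedean_halfspace :: "(real ^ 'n::finite) set \<Rightarrow> bool" where
  "archimedean_halfspace H \<longleftrightarrow>
     (\<exists>u v. positive_vec u \<and> positive_vec v \<and> u \<le> v \<and>
        H = {x \<in> nonneg_orthant.
              (MAX i\<in>UNIV. x $ i * inverse (u $ i)) \<le> (MAX i\<in>UNIV. x $ i * inverse (v $ i))})"

text \<open>
  \<^const>\<open>Greatest\<close> rather than \<^const>\<open>Max\<close>: the set of eigenvalues need not be finite.
\<close>

definition spectral_radius :: "(real ^ 'n::finite \<Rightarrow> real ^ 'n) \<Rightarrow> real" where
  "spectral_radius F =
     (GREATEST l. 0 \<le> l \<and> (\<exists>x \<in> nonneg_orthant - {0}. F x = l *\<^sub>R x))"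

end

theory Submission
  imports Defs
begin

text \<open>
  Write \<open>F = P\<^sub>k \<cdots> P\<^sub>1\<close>, an isotone homogeneous map with \<open>F x \<le> x\<close>.

  If the \<open>V\<^sub>i\<close> meet only in \<open>0\<close>, the decreasing orbit \<open>F\<^sup>m e\<close> of the all-ones vector \<open>e\<close> and the
  interlaced orbits in the \<open>V\<^sub>i\<close> have a common limit, which is therefore \<open>0\<close>; so \<open>F\<^sup>m e \<le> l\<^sup>m e\<close> for
  some \<open>l < 1\<close> and \<open>m \<ge> 1\<close>, and the entrywise minimum \<open>x\<close> of \<open>l\<^sup>-\<^sup>j F\<^sup>j e\<close>, \<open>j < m\<close>, satisfies \<open>F x \<le> l x\<close>.
  Given such a positive \<open>x\<close>, the halfspaces with \<open>u = P\<^sub>i \<cdots> P\<^sub>1 x\<close> and \<open>v = P\<^bsub>i-1\<^esub> \<cdots> P\<^sub>1 x\<close> separate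
  the \<open>V\<^sub>i\<close>.

  For the spectral radius no continuity is needed: an eigenvalue of \<open>F\<close> depends only on the support
  of its eigenvector, so there are finitely many, and the unit vectors are eigenvectors because
  \<open>F x \<le> x\<close>. An eigenvector for \<open>1\<close> is a common point of the \<open>V\<^sub>i\<close>.
\<close>

section \<open>Projectors\<close>

lemma subsemimodule_nonneg: "subsemimodule V \<Longrightarrow> u \<in> V \<Longrightarrow> 0 \<le> u"
  by (auto simp: subsemimodule_def nonneg_orthant_def)

lemma subsemimodule_scale: "subsemimodule V \<Longrightarrow> u \<in> V \<Longrightarrow> 0 \<le> a \<Longrightarrow> a *\<^sub>R u \<in> V"
  by (auto simp: subsemimodule_def)

text \<open>The part of \<open>V\<close> below \<open>x\<close> is compact, so the sum of entries
  has a maximizer \<open>u\<close> on it. This part is also closed under \<open>sup\<close>, so a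
  competitor \<open>w\<close> not below \<open>u\<close> would give \<open>sup u w\<close> a larger
  sum.\<close>

lemma projection_exists:
  fixes V :: "(real ^ 'n::finite) set"
  assumes V: "subsemimodule V" "closed V" and x: "0 \<le> x"
  shows "\<exists>u. u \<in> V \<and> u \<le> x \<and> (\<forall>w. w \<in> V \<and> w \<le> x \<longrightarrow> w \<le> u)"
proof -
  let ?K = "V \<inter> {0..x}"
  have "compact ?K"
    using V(2) compact_interval by (rule closed_Int_compact)
  moreover have "?K \<noteq> {}"
    using V x by (auto simp: subsemimodule_def)
  moreover have "continuous_on ?K (\<lambda>u. \<Sum>i\<in>UNIV. u $ i)"
    by (intro continuous_intros)
  ultimately obtain u where u: "u \<in> ?K" and
    max: "\<And>w. w \<in> ?K \<Longrightarrow> (\<Sum>i\<in>UNIV. w $ i) \<le> (\<Sum>i\<in>UNIV. u $ i)"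
    using continuous_attains_sup by metis
  have "w \<le> u" if w: "w \<in> V" "w \<le> x" for w
  proof -
    have "sup u w \<in> ?K"
      using u w V subsemimodule_nonneg[OF V(1)] by (auto simp: subsemimodule_def intro: le_supI1)
    then have le: "(\<Sum>i\<in>UNIV. sup u w $ i) \<le> (\<Sum>i\<in>UNIV. u $ i)"
      by (rule max)
    have ge: "u $ i \<le> sup u w $ i" for i
      using sup_ge1[of u w] by (simp add: less_eq_vec_def)
    have "u $ i = sup u w $ i" for i
    proof (rule ccontr)
      assume "u $ i \<noteq> sup u w $ i"
      then have "(\<Sum>i\<in>UNIV. u $ i) < (\<Sum>i\<in>UNIV. sup u w $ i)"
        using ge by (intro sum_strict_mono_ex1) (auto simp: order_less_le intro: exI[of _ i])
      with le show False by simp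
    qed
    then have "u = sup u w"
      by (simp add: vec_eq_iff)
    then show ?thesis
      by (metis sup_ge2)
  qed
  with u show ?thesis by auto
qed

context
  fixes V :: "(real ^ 'n::finite) set"
  assumes V: "subsemimodule V" "closed V"
begin

lemma projector_props:
  assumes "0 \<le> x"
  shows "projector V x \<in> V \<and> projector V x \<le> x \<and> (\<forall>w. w \<in> V \<and> w \<le> x \<longrightarrow> w \<le> projector V x)"
proof -
  obtain u where u: "u \<in> V \<and> u \<le> x" "\<And>w. w \<in> V \<and> w \<le> x \<Longrightarrow> w \<le> u"
    using projection_exists[OF V assms] by blast
  then have "projector V x = u"
    unfolding projector_def by (intro Greatest_equality) auto
  with u show ?thesis by blast
qed

lemma projector_mem: "0 \<le> x \<Longrightarrow> projector V x \<in> V"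
  and projector_le: "0 \<le> x \<Longrightarrow> projector V x \<le> x"
  and projector_greatest: "0 \<le> x \<Longrightarrow> w \<in> V \<Longrightarrow> w \<le> x \<Longrightarrow> w \<le> projector V x"
  using projector_props by blast+

lemma projector_nonneg: "0 \<le> x \<Longrightarrow> 0 \<le> projector V x"
  using projector_mem subsemimodule_nonneg[OF V(1)] by blast

lemma projector_mono: "0 \<le> x \<Longrightarrow> x \<le> y \<Longrightarrow> projector V x \<le> projector V y"
  by (meson order_trans projector_greatest projector_le projector_mem)

lemma projector_ident: "x \<in> V \<Longrightarrow> projector V x = x"
  by (simp add: antisym projector_greatest projector_le subsemimodule_nonneg[OF V(1)])

lemma projector_scale:
  assumes x: "0 \<le> x" and a: "0 \<le> a"
  shows "projector V (a *\<^sub>R x) = a *\<^sub>R projector V x"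
proof (cases "a = 0")
  case True
  then show ?thesis
    using V by (simp add: projector_ident subsemimodule_def)
next
  case False
  with a have a: "0 < a" by simp
  have ax: "0 \<le> a *\<^sub>R x"
    using x a by (simp add: scaleR_nonneg_nonneg)
  show ?thesis
  proof (rule antisym)
    have "inverse a *\<^sub>R projector V (a *\<^sub>R x) \<le> projector V x"
    proof (rule projector_greatest[OF x])
      show "inverse a *\<^sub>R projector V (a *\<^sub>R x) \<in> V"
        using a projector_mem[OF ax] subsemimodule_scale[OF V(1)] by simp
      have "inverse a *\<^sub>R projector V (a *\<^sub>R x) \<le> inverse a *\<^sub>R (a *\<^sub>R x)"
        using a projector_le[OF ax] by (intro scaleR_left_mono) auto
      then show "inverse a *\<^sub>R projector V (a *\<^sub>R x) \<le> x"
        using a by simp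
    qed
    then have "a *\<^sub>R (inverse a *\<^sub>R projector V (a *\<^sub>R x)) \<le> a *\<^sub>R projector V x"
      using a by (intro scaleR_left_mono) auto
    then show "projector V (a *\<^sub>R x) \<le> a *\<^sub>R projector V x"
      using a by simp
    show "a *\<^sub>R projector V x \<le> projector V (a *\<^sub>R x)"
      using a x ax projector_mem projector_le subsemimodule_scale[OF V(1)]
      by (intro projector_greatest scaleR_left_mono) auto
  qed
qed

end

section \<open>Positive vectors and maxima of ratios\<close>

lemma positive_vec_nonneg: "positive_vec x \<Longrightarrow> 0 \<le> x"
  by (auto simp: positive_vec_def less_eq_vec_def intro: less_imp_le)

text \<open>Characterizes the maximum of ratios as the least \<open>c\<close> with
  \<open>x \<le> c *\<^sub>R u\<close>, so that halfspace inequalities become order comparisons with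
  multiples of positive vectors.\<close>

lemma positive_vec_ratio_max:
  assumes "positive_vec (u :: real ^ 'n::finite)"
  shows "(MAX i\<in>UNIV. x $ i * inverse (u $ i)) \<le> c \<longleftrightarrow> x \<le> c *\<^sub>R u"
  using assms by (subst Max_le_iff) (auto simp: less_eq_vec_def positive_vec_def field_simps)

text \<open>A positive vector of \<open>V\<close>, scaled down until it fits below \<open>x\<close>,
  bounds the projection from below.\<close>

lemma projector_positive:
  fixes V :: "(real ^ 'n::finite) set"
  assumes V: "archimedean_subsemimodule V" "closed V" and x: "positive_vec x"
  shows "positive_vec (projector V x)"
proof -
  have sub: "subsemimodule V"
    using V(1) by (simp add: archimedean_subsemimodule_def)
  obtain v where v: "v \<in> V" "positive_vec v"
    using V(1) by (auto simp: archimedean_subsemimodule_def)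
  \<comment> \<open>The ratios give \<open>v \<le> c *\<^sub>R x\<close>; the 1 ensures that
    \<open>c\<close> is positive and can be inverted.\<close>
  define c where "c = max 1 (MAX i\<in>UNIV. v $ i * inverse (x $ i))"
  have c: "0 < c" "v \<le> c *\<^sub>R x"
    unfolding positive_vec_ratio_max[OF x, symmetric] c_def by auto
  have "inverse c *\<^sub>R v \<le> inverse c *\<^sub>R (c *\<^sub>R x)"
    using c by (intro scaleR_left_mono) auto
  then have "inverse c *\<^sub>R v \<le> projector V x"
    using c v positive_vec_nonneg[OF x] subsemimodule_scale[OF sub]
    by (intro projector_greatest[OF sub V(2)]) auto
  moreover have "0 < (inverse c *\<^sub>R v) $ i" for i
    using c v by (simp add: positive_vec_def)
  ultimately show ?thesis
    unfolding positive_vec_def less_eq_vec_def by (meson less_le_trans)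
qed

section \<open>Eigenvalues of isotone homogeneous maps below the identity\<close>

text \<open>By the support condition some multiple of \<open>x\<close> dominates \<open>y\<close>.
  The least one, \<open>c *\<^sub>R x\<close>, touches \<open>y\<close> at a coordinate
  \<open>i\<close>; applying \<open>F\<close> to \<open>y \<le> c *\<^sub>R x\<close> and reading
  off coordinate \<open>i\<close> compares \<open>m\<close> with \<open>l\<close>.\<close>

lemma eigenvalue_le:
  fixes F :: "real ^ 'n::finite \<Rightarrow> real ^ 'n"
  assumes mono: "\<And>x y. 0 \<le> x \<Longrightarrow> x \<le> y \<Longrightarrow> F x \<le> F y"
    and hom: "\<And>a x. 0 \<le> a \<Longrightarrow> 0 \<le> x \<Longrightarrow> F (a *\<^sub>R x) = a *\<^sub>R F x"
    and x: "0 \<le> x" "F x = l *\<^sub>R x" and y: "0 \<le> y" "y \<noteq> 0" "F y = m *\<^sub>R y"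
    and supp: "\<And>i. x $ i = 0 \<Longrightarrow> y $ i = 0"
  shows "m \<le> l"
proof -
  have x0: "0 \<le> x $ i" and y0: "0 \<le> y $ i" for i
    using x y by (auto simp: less_eq_vec_def)
  \<comment> \<open>Where \<open>x $ j = 0\<close> the quotient is 0 by convention;
    \<open>supp\<close> makes \<open>y $ j\<close> vanish there too, so these entries do no
    harm.\<close>
  obtain i where max: "\<And>j. y $ j / x $ j \<le> y $ i / x $ i"
  proof -
    define R where "R = range (\<lambda>j. y $ j / x $ j)"
    have "Max R \<in> R"
      unfolding R_def by (intro Max_in) auto
    then obtain i where i: "Max R = y $ i / x $ i"
      unfolding R_def image_iff by blast
    have "y $ j / x $ j \<le> Max R" for j
      unfolding R_def by (intro Max_ge) auto
    then have "y $ j / x $ j \<le> y $ i / x $ i" for j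
      unfolding i .
    then show thesis by (rule that)
  qed
  obtain j where "y $ j \<noteq> 0"
    using y(2) by (auto simp: vec_eq_iff)
  then have "0 < y $ j / x $ j"
    using supp x0 y0 by (metis divide_pos_pos order_less_le)
  then have pos: "0 < y $ i / x $ i"
    using max less_le_trans by blast
  define c where "c = y $ i / x $ i"
  have xi: "0 < x $ i" and yi: "0 < y $ i"
    using pos x0[of i] y0[of i] by (auto simp: zero_less_divide_iff)
  have "y \<le> c *\<^sub>R x"
    unfolding less_eq_vec_def
  proof
    fix j
    show "y $ j \<le> (c *\<^sub>R x) $ j"
      using max[of j] supp[of j] x0[of j] unfolding c_def[symmetric]
      by (cases "x $ j = 0") (auto simp: divide_le_eq split: if_splits)
  qed
  then have "F y \<le> F (c *\<^sub>R x)"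
    by (rule mono[OF y(1)])
  also have "\<dots> = c *\<^sub>R F x"
    using hom x pos by (simp add: c_def less_imp_le)
  finally have "m *\<^sub>R y \<le> c *\<^sub>R l *\<^sub>R x"
    using x y by simp
  then have "m * y $ i \<le> c * (l * x $ i)"
    by (simp add: less_eq_vec_def mult.assoc)
  also have "\<dots> = l * y $ i"
    using xi by (simp add: c_def)
  finally show ?thesis
    using yi by simp
qed

text \<open>Shows that the \<open>GREATEST\<close> defining the spectral radius is attained, so that
  it behaves as a true maximum.\<close>

lemma spectral_radius_eigenvalue:
  fixes F :: "real ^ 'n::finite \<Rightarrow> real ^ 'n"
  assumes mono: "\<And>x y. 0 \<le> x \<Longrightarrow> x \<le> y \<Longrightarrow> F x \<le> F y"
    and hom: "\<And>a x. 0 \<le> a \<Longrightarrow> 0 \<le> x \<Longrightarrow> F (a *\<^sub>R x) = a *\<^sub>R F x"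
    and nonneg: "\<And>x. 0 \<le> x \<Longrightarrow> 0 \<le> F x"
    and le: "\<And>x. 0 \<le> x \<Longrightarrow> F x \<le> x"
  shows "\<exists>x. 0 \<le> x \<and> x \<noteq> 0 \<and> F x = spectral_radius F *\<^sub>R x"
    and "\<And>l x. 0 \<le> l \<Longrightarrow> 0 \<le> x \<Longrightarrow> x \<noteq> 0 \<Longrightarrow> F x = l *\<^sub>R x \<Longrightarrow> l \<le> spectral_radius F"
proof -
  define E where "E = {l. 0 \<le> l \<and> (\<exists>x \<in> nonneg_orthant - {0}. F x = l *\<^sub>R x)}"
  define w where "w l = (SOME x. 0 \<le> x \<and> x \<noteq> 0 \<and> F x = l *\<^sub>R x)" for l
  have w: "0 \<le> w l" "w l \<noteq> 0" "F (w l) = l *\<^sub>R w l" if "l \<in> E" for l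
  proof -
    have "\<exists>x. 0 \<le> x \<and> x \<noteq> 0 \<and> F x = l *\<^sub>R x"
      using that by (auto simp: E_def nonneg_orthant_def)
    from someI_ex[OF this] show "0 \<le> w l" "w l \<noteq> 0" "F (w l) = l *\<^sub>R w l"
      unfolding w_def by auto
  qed
  \<comment> \<open>Equal zero sets allow \<open>eigenvalue_le\<close> in both directions, so the
    zero set determines the eigenvalue, and there are only finitely many zero sets.\<close>
  have "inj_on (\<lambda>l. {i. w l $ i = 0}) E"
  proof (rule inj_onI)
    fix l m assume lm: "l \<in> E" "m \<in> E" and eq: "{i. w l $ i = 0} = {i. w m $ i = 0}"
    have "m \<le> l"
      using eq by (intro eigenvalue_le[OF mono hom w(1)[OF lm(1)] w(3)[OF lm(1)] w[OF lm(2)]]) auto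
    moreover have "l \<le> m"
      using eq by (intro eigenvalue_le[OF mono hom w(1)[OF lm(2)] w(3)[OF lm(2)] w[OF lm(1)]]) auto
    ultimately show "l = m" by simp
  qed
  then have fin: "finite E"
    by (rule inj_on_finite[where B = UNIV]) auto
  have "E \<noteq> {}"
  proof -
    fix j :: 'n
    let ?e = "axis j 1 :: real ^ 'n"
    have e: "0 \<le> ?e" "?e \<noteq> 0"
      by (auto simp: less_eq_vec_def axis_def vec_eq_iff)
    have bounds: "0 \<le> F ?e $ i" "F ?e $ i \<le> ?e $ i" for i
      using nonneg[OF e(1)] le[OF e(1)] by (auto simp: less_eq_vec_def)
    \<comment> \<open>Squeezed between 0 and the unit vector, \<open>F ?e\<close> vanishes off
      coordinate \<open>j\<close>.\<close>
    have "F ?e $ i = (F ?e $ j *\<^sub>R ?e) $ i" for i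
      using bounds[of i] by (cases "i = j") (auto simp: axis_def)
    then have "F ?e = F ?e $ j *\<^sub>R ?e"
      unfolding vec_eq_iff by blast
    then have "F ?e $ j \<in> E"
      using e bounds[of j] unfolding E_def nonneg_orthant_def by blast
    then show ?thesis by blast
  qed
  with fin have Max: "Max E \<in> E" "\<And>l. l \<in> E \<Longrightarrow> l \<le> Max E"
    by (auto intro: Max_in)
  have "spectral_radius F = Max E"
    unfolding spectral_radius_def
    by (rule Greatest_equality) (use Max in \<open>auto simp: E_def\<close>)
  then show "\<exists>x. 0 \<le> x \<and> x \<noteq> 0 \<and> F x = spectral_radius F *\<^sub>R x"
    using w[OF Max(1)] by metis
  show "l \<le> spectral_radius F" if "0 \<le> l" "0 \<le> x" "x \<noteq> 0" "F x = l *\<^sub>R x" for l x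
    using that Max(2)[of l] \<open>spectral_radius F = Max E\<close> by (auto simp: E_def nonneg_orthant_def)
qed

text \<open>On the rescaled orbit \<open>a\<close>, the map \<open>F\<close> is a shift times
  \<open>l\<close>, and \<open>pow\<close> closes the orbit up to an inequality,
  \<open>a m \<le> a 0\<close>. By isotonicity \<open>F\<close> sends the minimum over one period
  below \<open>l\<close> times each term.\<close>

lemma subeigenvector_of_power:
  fixes F :: "real ^ 'n::finite \<Rightarrow> real ^ 'n"
  assumes mono: "\<And>x y. 0 \<le> x \<Longrightarrow> x \<le> y \<Longrightarrow> F x \<le> F y"
    and hom: "\<And>a x. 0 \<le> a \<Longrightarrow> 0 \<le> x \<Longrightarrow> F (a *\<^sub>R x) = a *\<^sub>R F x"
    and pos: "\<And>x. positive_vec x \<Longrightarrow> positive_vec (F x)"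
    and e: "positive_vec e" and m: "1 \<le> m" and l: "0 < l"
    and pow: "(F ^^ m) e \<le> l ^ m *\<^sub>R e"
  shows "\<exists>x. positive_vec x \<and> F x \<le> l *\<^sub>R x"
proof -
  define a where "a j = inverse (l ^ j) *\<^sub>R (F ^^ j) e" for j
  have iter_pos: "positive_vec ((F ^^ j) e)" for j
    by (induction j) (auto simp: e pos)
  then have a_pos: "positive_vec (a j)" for j
    using l by (simp add: a_def positive_vec_def)
  have F_a: "F (a j) = l *\<^sub>R a (Suc j)" for j
    using l positive_vec_nonneg[OF iter_pos] by (simp add: a_def hom)
  define x :: "real ^ 'n" where "x = (\<chi> i. MIN j\<in>{..<m}. a j $ i)"
  have ne: "{..<m} \<noteq> {}"
    using m by (simp add: lessThan_empty_iff)
  have x_le: "x $ i \<le> a j $ i" if "j < m" for i j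
    using that by (simp add: x_def)
  have x_pos: "positive_vec x"
    using a_pos ne by (auto simp: x_def positive_vec_def)
  have Fx_le: "F x $ i \<le> l * a j $ i" if "j \<le> m" "1 \<le> j" for i j
  proof -
    obtain j' where j': "j = Suc j'" "j' < m"
      using \<open>j \<le> m\<close> \<open>1 \<le> j\<close> by (metis One_nat_def Suc_le_D Suc_le_lessD)
    then have "x \<le> a j'"
      using x_le by (simp add: less_eq_vec_def)
    then have "F x \<le> F (a j')"
      by (rule mono[OF positive_vec_nonneg[OF x_pos]])
    then show ?thesis
      by (simp add: F_a j' less_eq_vec_def)
  qed
  have "a m \<le> a 0"
    using scaleR_left_mono[OF pow, of "inverse (l ^ m)"] l by (simp add: a_def)
  then have a_m: "a m $ i \<le> a 0 $ i" for i
    by (simp add: less_eq_vec_def)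
  \<comment> \<open>The term \<open>a 0\<close> is not a shifted one; its bound comes from
    \<open>j = m\<close> and \<open>a m \<le> a 0\<close>.\<close>
  have Fx_le': "F x $ i \<le> l * a j $ i" if "j < m" for i j
  proof (cases "j = 0")
    case True
    then show ?thesis
      using Fx_le[of m i] m a_m[of i] l by (auto intro: order_trans)
  next
    case False
    then show ?thesis
      using Fx_le that by simp
  qed
  have "F x \<le> l *\<^sub>R x"
    unfolding less_eq_vec_def
  proof
    fix i
    have "x $ i \<in> (\<lambda>j. a j $ i) ` {..<m}"
      unfolding x_def using ne by (simp only: vec_lambda_beta) (intro Min_in, auto)
    then show "F x $ i \<le> (l *\<^sub>R x) $ i"
      using Fx_le' by auto
  qed
  with x_pos show ?thesis by blast
qed

section \<open>The cyclic projector\<close>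

locale closed_semimodule_family =
  fixes V :: "nat \<Rightarrow> (real ^ 'n::finite) set" and k :: nat
  assumes archimedean: "\<And>i. i \<in> {1..k} \<Longrightarrow> archimedean_subsemimodule (V i)"
    and closed: "\<And>i. i \<in> {1..k} \<Longrightarrow> closed (V i)"
begin

lemma sub: "i \<in> {1..k} \<Longrightarrow> subsemimodule (V i)"
  using archimedean by (simp add: archimedean_subsemimodule_def)

lemma cyclic_nonneg: "i \<le> k \<Longrightarrow> 0 \<le> x \<Longrightarrow> 0 \<le> cyclic_projector V i x"
  by (induction i) (auto intro!: projector_nonneg sub closed)

lemma cyclic_mem: "i \<in> {1..k} \<Longrightarrow> 0 \<le> x \<Longrightarrow> cyclic_projector V i x \<in> V i"
  by (cases i) (auto intro!: projector_mem sub closed cyclic_nonneg)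

lemma cyclic_step: "Suc i \<le> k \<Longrightarrow> 0 \<le> x \<Longrightarrow> cyclic_projector V (Suc i) x \<le> cyclic_projector V i x"
  by (auto intro!: projector_le sub closed cyclic_nonneg)

lemma cyclic_antimono:
  assumes "i \<le> j" "j \<le> k" "0 \<le> x"
  shows "cyclic_projector V j x \<le> cyclic_projector V i x"
  using assms by (induction j rule: dec_induct) (auto intro: order_trans[OF cyclic_step] simp del: cyclic_projector.simps)

lemma cyclic_le: "i \<le> k \<Longrightarrow> 0 \<le> x \<Longrightarrow> cyclic_projector V i x \<le> x"
  using cyclic_antimono[of 0 i x] by simp

lemma cyclic_mono: "i \<le> k \<Longrightarrow> 0 \<le> x \<Longrightarrow> x \<le> y \<Longrightarrow> cyclic_projector V i x \<le> cyclic_projector V i y"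
  by (induction i) (auto intro!: projector_mono sub closed cyclic_nonneg)

lemma cyclic_scale:
  "i \<le> k \<Longrightarrow> 0 \<le> a \<Longrightarrow> 0 \<le> x \<Longrightarrow> cyclic_projector V i (a *\<^sub>R x) = a *\<^sub>R cyclic_projector V i x"
  by (induction i) (auto intro!: projector_scale sub closed cyclic_nonneg)

lemma cyclic_positive: "i \<le> k \<Longrightarrow> positive_vec x \<Longrightarrow> positive_vec (cyclic_projector V i x)"
  by (induction i) (auto intro!: projector_positive archimedean closed)

text \<open>The partial compositions decrease from \<open>x\<close> to
  \<open>cyclic_projector V k x\<close>; if the two ends agree, every one of them equals
  \<open>x\<close>.\<close>

lemma cyclic_fixed:
  assumes x: "0 \<le> x"
  shows "cyclic_projector V k x = x \<longleftrightarrow> x \<in> (\<Inter>i\<in>{1..k}. V i)"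
proof
  assume fixed: "cyclic_projector V k x = x"
  show "x \<in> (\<Inter>i\<in>{1..k}. V i)"
  proof
    fix i assume i: "i \<in> {1..k}"
    have "cyclic_projector V i x = x"
      using i x cyclic_antimono[of i k x] cyclic_le[of i x] fixed by (auto intro: antisym)
    then show "x \<in> V i"
      using cyclic_mem[OF i x] by simp
  qed
next
  assume mem: "x \<in> (\<Inter>i\<in>{1..k}. V i)"
  have "i \<le> k \<Longrightarrow> cyclic_projector V i x = x" for i
    by (induction i) (use mem in \<open>auto intro!: projector_ident sub closed\<close>)
  then show "cyclic_projector V k x = x" by simp
qed

section \<open>The implications between the conditions\<close>

lemma zero_mem_Inter: "0 \<in> (\<Inter>i\<in>{1..k}. V i)"
  using sub by (auto simp: subsemimodule_def)

lemma Inter_trivial_iff_spectral_radius: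
  assumes k: "1 \<le> k"
  shows "(\<Inter>i\<in>{1..k}. V i) = {0} \<longleftrightarrow> spectral_radius (cyclic_projector V k) < 1"
proof -
  let ?F = "cyclic_projector V k"
  \<comment> \<open>The reflexivity facts discharge the side condition \<open>i \<le> k\<close> at
    \<open>i = k\<close>.\<close>
  note eig = spectral_radius_eigenvalue[of ?F, OF cyclic_mono cyclic_scale cyclic_nonneg cyclic_le,
    OF order_refl _ _ order_refl _ _ order_refl _ order_refl]
  show ?thesis
  proof
    assume triv: "(\<Inter>i\<in>{1..k}. V i) = {0}"
    obtain x where x: "0 \<le> x" "x \<noteq> 0" "?F x = spectral_radius ?F *\<^sub>R x"
      using eig(1) by auto
    obtain i where "x $ i \<noteq> 0"
      using x(2) by (auto simp: vec_eq_iff)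
    with x(1) have xi: "0 < x $ i"
      by (auto simp: less_eq_vec_def order_less_le)
    have "spectral_radius ?F * x $ i \<le> x $ i"
      using cyclic_le[OF order_refl x(1)] x(3) by (simp add: less_eq_vec_def)
    with xi have "spectral_radius ?F \<le> 1"
      by simp
    moreover have "spectral_radius ?F \<noteq> 1"
      using cyclic_fixed[OF x(1)] x triv by auto
    ultimately show "spectral_radius ?F < 1" by simp
  next
    assume less: "spectral_radius ?F < 1"
    have "x = 0" if x: "x \<in> (\<Inter>i\<in>{1..k}. V i)" for x
    proof (rule ccontr)
      assume "x \<noteq> 0"
      moreover have "0 \<le> x"
        using x k sub[of 1] by (auto intro: subsemimodule_nonneg)
      ultimately have "1 \<le> spectral_radius ?F"
        using cyclic_fixed[of x] x by (intro eig(2)[of 1 x]) auto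
      with less show False by simp
    qed
    with zero_mem_Inter show "(\<Inter>i\<in>{1..k}. V i) = {0}" by auto
  qed
qed

lemma subeigenvector_if_Inter_trivial:
  assumes k: "1 \<le> k" and triv: "(\<Inter>i\<in>{1..k}. V i) = {0}"
  shows "\<exists>x l. positive_vec x \<and> 0 \<le> l \<and> l < 1 \<and> cyclic_projector V k x \<le> l *\<^sub>R x"
proof -
  let ?F = "cyclic_projector V k"
  define e :: "real ^ 'n" where "e = (\<chi> i. 1)"
  have e: "positive_vec e"
    by (simp add: e_def positive_vec_def)
  define a where "a m = (?F ^^ m) e" for m
  have a_Suc: "a (Suc m) = ?F (a m)" for m
    by (simp add: a_def)
  have a_nonneg: "0 \<le> a m" for m
    by (induction m) (auto simp: a_def positive_vec_nonneg[OF e] cyclic_nonneg)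
  have dec: "decseq (\<lambda>m. a m $ i)" for i
    using cyclic_le[OF order_refl a_nonneg] by (auto simp: decseq_Suc_iff a_Suc less_eq_vec_def)
  have "\<exists>L. (\<lambda>m. a m $ i) \<longlonglongrightarrow> L" for i
  proof -
    have "0 \<le> a m $ i" for m
      using a_nonneg[of m] by (simp add: less_eq_vec_def)
    then show ?thesis
      using decseq_convergent[OF dec, of 0 i] by blast
  qed
  then obtain L where L: "\<And>i. (\<lambda>m. a m $ i) \<longlonglongrightarrow> L i"
    by metis
  define y where "y = (\<chi> i. L i)"
  have lim: "(\<lambda>m. a m $ i) \<longlonglongrightarrow> y $ i" for i
    using L by (simp add: y_def)
  \<comment> \<open>The points \<open>cyclic_projector V i (a m)\<close> of \<open>V i\<close> lie
    between \<open>a (Suc m)\<close> and \<open>a m\<close>, hence also tend to \<open>y\<close>.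
    This squeeze takes the place of continuity of the projectors.\<close>
  have "y \<in> V i" if i: "i \<in> {1..k}" for i
  proof (rule closed_sequentially[OF closed[OF i]])
    show "cyclic_projector V i (a m) \<in> V i" for m
      using cyclic_mem[OF i a_nonneg] .
    show "(\<lambda>m. cyclic_projector V i (a m)) \<longlonglongrightarrow> y"
    proof (rule vec_tendstoI)
      fix j
      show "(\<lambda>m. cyclic_projector V i (a m) $ j) \<longlonglongrightarrow> y $ j"
      proof (rule tendsto_sandwich)
        show "(\<lambda>m. a (Suc m) $ j) \<longlonglongrightarrow> y $ j"
          using lim by (rule LIMSEQ_Suc)
        show "(\<lambda>m. a m $ j) \<longlonglongrightarrow> y $ j"
          by (rule lim)
        show "\<forall>\<^sub>F m in sequentially. a (Suc m) $ j \<le> cyclic_projector V i (a m) $ j"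
          using cyclic_antimono[of i k] i a_nonneg by (auto simp: a_Suc less_eq_vec_def)
        show "\<forall>\<^sub>F m in sequentially. cyclic_projector V i (a m) $ j \<le> a m $ j"
          using cyclic_le[of i] i a_nonneg by (auto simp: less_eq_vec_def)
      qed
    qed
  qed
  with triv have "y = 0" by blast
  with lim have "\<forall>\<^sub>F m in sequentially. a m $ i < 1/2" for i
    by (intro order_tendstoD(2)) auto
  \<comment> \<open>Finitely many coordinates allow one common \<open>m\<close>. Any bound strictly
    between 0 and 1 would serve as well as 1/2.\<close>
  then have "\<forall>\<^sub>F m in sequentially. \<forall>i\<in>UNIV. a m $ i < 1/2"
    by (intro eventually_ball_finite) auto
  then obtain m where m: "\<And>i. a m $ i < 1/2"
    by (auto simp: eventually_sequentially)
  \<comment> \<open>\<open>a 0\<close> is the all-ones vector, which violates the bound 1/2; hence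
    the \<open>m\<close>-th root below is a genuine one.\<close>
  have "m \<noteq> 0"
    using m by (intro notI) (simp add: a_def e_def)
  define l where "l = root m (1/2)"
  have l: "0 < l" "l < 1" "l ^ m = 1/2"
    using \<open>m \<noteq> 0\<close> by (auto simp: l_def)
  have pow: "(?F ^^ m) e \<le> l ^ m *\<^sub>R e"
    using m by (simp add: l a_def less_eq_vec_def e_def less_imp_le)
  have "\<exists>x. positive_vec x \<and> ?F x \<le> l *\<^sub>R x"
    using subeigenvector_of_power[of ?F, OF cyclic_mono cyclic_scale cyclic_positive e _ l(1) pow] \<open>m \<noteq> 0\<close>
    by simp
  with l show ?thesis by (meson less_imp_le)
qed

text \<open>\<open>M i y\<close> is the least \<open>c\<close> with
  \<open>y \<le> c *\<^sub>R z i\<close>, and \<open>H i\<close> says that it does not grow from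
  index \<open>i - 1\<close> to \<open>i\<close>. For a common point these inequalities chain from
  \<open>z 0 = x\<close> to \<open>z k \<le> l *\<^sub>R x\<close>, which is possible only for
  0.\<close>

lemma halfspaces_if_subeigenvector:
  assumes k: "1 \<le> k" and x: "positive_vec x" and l: "l < 1" "cyclic_projector V k x \<le> l *\<^sub>R x"
  shows "\<exists>H. (\<forall>i\<in>{1..k}. archimedean_halfspace (H i) \<and> V i \<subseteq> H i) \<and> (\<Inter>i\<in>{1..k}. H i) = {0}"
proof -
  define z where "z i = cyclic_projector V i x" for i
  define M where "M i y = (MAX j\<in>UNIV. y $ j * inverse (z i $ j))" for i and y :: "real ^ 'n"
  define H where "H i = {y \<in> nonneg_orthant. M i y \<le> M (i - 1) y}" for i
  have z_pos: "positive_vec (z i)" if "i \<le> k" for i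
    using that x by (simp add: z_def cyclic_positive)
  have M_le: "M i y \<le> c \<longleftrightarrow> y \<le> c *\<^sub>R z i" if "i \<le> k" for i y c
    unfolding M_def using positive_vec_ratio_max[OF z_pos[OF that]] .
  have M_nonneg: "0 \<le> M i y" if "i \<le> k" "0 \<le> y" for i y
  proof -
    fix j :: 'n
    have "0 \<le> y $ j * inverse (z i $ j)"
      using that z_pos[OF that(1)] by (auto simp: positive_vec_def less_eq_vec_def less_imp_le)
    also have "\<dots> \<le> M i y"
      unfolding M_def by (intro Max_ge) auto
    finally show ?thesis .
  qed
  have half: "archimedean_halfspace (H i)" if "i \<in> {1..k}" for i
  proof -
    have "z i \<le> z (i - 1)"
      using that positive_vec_nonneg[OF x] by (simp add: z_def cyclic_antimono)
    moreover have "positive_vec (z i)" "positive_vec (z (i - 1))"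
      using that by (auto intro: z_pos)
    ultimately show ?thesis
      unfolding archimedean_halfspace_def H_def M_def
      by (intro exI[of _ "z i"] exI[of _ "z (i - 1)"] conjI refl)
  qed
  have V_H: "V i \<subseteq> H i" if i: "i \<in> {1..k}" for i
  proof
    fix y assume y: "y \<in> V i"
    then have y0: "0 \<le> y"
      using sub[OF i] by (rule subsemimodule_nonneg[rotated])
    \<comment> \<open>The least multiple of \<open>z (i - 1)\<close> above \<open>y\<close>. As
      \<open>y\<close> lies in \<open>V i\<close>, it stays below the projection of that multiple,
      which is \<open>c *\<^sub>R z i\<close>.\<close>
    define c where "c = M (i - 1) y"
    have c: "0 \<le> c" "y \<le> c *\<^sub>R z (i - 1)"
      using M_le[of "i - 1" y c] M_nonneg[of "i - 1"] i y0 by (auto simp: c_def)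
    have z0: "0 \<le> z (i - 1)"
      using i by (intro positive_vec_nonneg z_pos) auto
    have "y \<le> projector (V i) (c *\<^sub>R z (i - 1))"
      using c y z0 by (intro projector_greatest[OF sub[OF i] closed[OF i]] scaleR_nonneg_nonneg)
    also have "\<dots> = c *\<^sub>R z i"
      using i projector_scale[OF sub[OF i] closed[OF i] z0 c(1)]
      by (cases i) (auto simp: z_def)
    finally have "M i y \<le> M (i - 1) y"
      using i M_le by (simp add: c_def)
    with y0 show "y \<in> H i"
      by (simp add: H_def nonneg_orthant_def)
  qed
  have "y = 0" if y: "y \<in> (\<Inter>i\<in>{1..k}. H i)" for y
  proof -
    \<comment> \<open>Since \<open>1 \<le> k\<close>, the intersection is over a nonempty family and
      lies in the orthant.\<close>
    have y0: "0 \<le> y"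
      using y k by (auto simp: H_def nonneg_orthant_def)
    have "i \<le> k \<Longrightarrow> M i y \<le> M 0 y" for i
    proof (induction i)
      case (Suc i)
      then have "y \<in> H (Suc i)"
        using y by auto
      then have "M (Suc i) y \<le> M i y"
        by (simp add: H_def)
      with Suc show ?case by simp
    qed simp
    then have "y \<le> M 0 y *\<^sub>R z k"
      using M_le[of k y "M 0 y"] by simp
    also have "\<dots> \<le> M 0 y *\<^sub>R (l *\<^sub>R x)"
      using l M_nonneg[of 0] y0 by (intro scaleR_left_mono) (auto simp: z_def)
    \<comment> \<open>\<open>y\<close> is below \<open>M 0 y * l\<close> times
      \<open>x = z 0\<close>, and \<open>M 0 y\<close> is the least such factor.\<close>
    finally have "M 0 y \<le> M 0 y * l"
      using M_le[of 0] by (simp add: z_def)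
    then have "M 0 y = 0"
      using l M_nonneg[of 0, OF _ y0] by (simp add: mult_le_cancel_left1)
    then have "y \<le> 0"
      using M_le[of 0 y 0] by simp
    with y0 show "y = 0" by (rule antisym[rotated])
  qed
  moreover have "0 \<in> H i" if "i \<in> {1..k}" for i
    using V_H[OF that] sub[OF that] by (auto simp: subsemimodule_def)
  ultimately have "(\<Inter>i\<in>{1..k}. H i) = {0}" by blast
  with half V_H show ?thesis by blast
qed

end

theorem theorem19:
  fixes V :: "nat \<Rightarrow> (real ^ 'n::finite) set" and k :: nat
  assumes "1 \<le> k"
    and "\<And>i. i \<in> {1..k} \<Longrightarrow> archimedean_subsemimodule (V i)"
    and "\<And>i. i \<in> {1..k} \<Longrightarrow> closed (V i)"
  shows
    "((\<exists>x. \<exists>l::real. positive_vec x \<and> 0 \<le> l \<and> l < 1 \<and> cyclic_projector V k x \<le> l *\<^sub>R x)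
      \<longleftrightarrow> (\<exists>H. (\<forall>i\<in>{1..k}. archimedean_halfspace (H i) \<and> V i \<subseteq> H i) \<and> (\<Inter>i\<in>{1..k}. H i) = {0}))
   \<and> ((\<exists>H. (\<forall>i\<in>{1..k}. archimedean_halfspace (H i) \<and> V i \<subseteq> H i) \<and> (\<Inter>i\<in>{1..k}. H i) = {0})
      \<longleftrightarrow> (\<Inter>i\<in>{1..k}. V i) = {0})
   \<and> ((\<Inter>i\<in>{1..k}. V i) = {0}
      \<longleftrightarrow> spectral_radius (cyclic_projector V k) < 1)"
    (is "(?subeig \<longleftrightarrow> ?half) \<and> (?half \<longleftrightarrow> ?triv) \<and> (?triv \<longleftrightarrow> ?spec)")
proof -
  interpret closed_semimodule_family V k
    using assms(2,3) by unfold_locales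
  \<comment> \<open>The first three conditions are linked in a cycle; the spectral radius is then
    attached to \<open>?triv\<close>.\<close>
  have "?half" if "?subeig"
    using that halfspaces_if_subeigenvector[OF assms(1)] by blast
  moreover have "?triv" if "?half"
  proof -
    from that obtain H where H: "\<And>i. i \<in> {1..k} \<Longrightarrow> V i \<subseteq> H i" "(\<Inter>i\<in>{1..k}. H i) = {0}"
      by blast
    then have "(\<Inter>i\<in>{1..k}. V i) \<subseteq> {0}" by blast
    with zero_mem_Inter show ?thesis by blast
  qed
  moreover have "?subeig" if "?triv"
    using subeigenvector_if_Inter_trivial[OF assms(1) that] .
  ultimately show ?thesis
    using Inter_trivial_iff_spectral_radius[OF assms(1)] by argo
qed

end
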